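(* Suppose $\det(\nu_{i+j,n})_{i,j=0}^{n}\neq0$ for all $n\ge0$. Let $\Delta''_n=\det(\nu_{i+j,j})_{0\le i,j\le n}$ and $\Delta'''_n=\det(\nu_{i,j})_{0\le i,j\le n}$. If moreover $\lambda_k\neq0$ for all $k$, then \[ Q_n(x)=\frac{1}{\Delta''_n}\det\begin{pmatrix}(\nu_{i+j,j})_{0\le i\le n-1,\ 0\le j\le n}\\ \left(\frac{x^j}{d_j(x)}\right)_{0\le j\le n}\end{pmatrix}. \] Also, \[ Q_n(x)=\frac{1}{\Delta'''_n}\det\begin{pmatrix}(\nu_{i,j})_{0\le i\le n-1,\ 0\le j\le n}\\ \left(\frac{1}{d_j(x)}\right)_{0\le j\le n}\end{pmatrix}. \]
   Context: Let $\{b_n\}_{n\ge0},\{a_n\}_{n\ge0},\{\lambda_n\}_{n\ge0}$ be sequences of complex numbers. Define monic polynomials $P_n(x)$ by $P_{-1}(x)=0$, $P_0(x)=1$ and $P_{n+1}(x)=(x-b_n)P_n(x)-(a_nx+\lambda_n)P_{n-1}(x)$ for $n\ge0$. Let $d_0(x)=1$, $d_m(x)=\prod_{i=1}^m(a_ix+\lambda_i)$, and $Q_m(x)=P_m(x)/d_m(x)$. Assume $a_n\neq0$ and $P_n(-\lambda_n/a_n)\neq 0$ for all $n\ge1$. Let $V=\mathrm{span}\{x^nQ_m(x):n,m\ge0\}$ (rational functions; it contains every $x^n/d_m(x)$), and let $\mathcal{L}$ be the unique linear functional on $V$ with $\mathcal{L}(1)=1$ and $\mathcal{L}(x^nQ_m(x))=0$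 whenever $0\le n<m$. Set $\nu_{n,m}=\mathcal{L}(x^n/d_m(x))$. In each determinant, the first $n$ rows are indexed by $i=0,\dots,n-1$ and the last row is the displayed row of functions. *)

theory Defs
  imports "Jordan_Normal_Form.Determinant"
begin

type_synonym ratfun = "complex poly fract"

abbreviation ratconst :: "complex \<Rightarrow> ratfun" where
  "ratconst c \<equiv> to_fract [:c:]"

abbreviation ratX :: ratfun where
  "ratX \<equiv> to_fract [:0, 1:]"

definition ratscale :: "complex \<Rightarrow> ratfun \<Rightarrow> ratfun" where
  "ratscale c f = ratconst c * f"

lemma ratconst_add: "ratconst (c + d) = ratconst c + ratconst d"
  by (simp flip: to_fract_add)

lemma ratconst_mult: "ratconst (c * d) = ratconst c * ratconst d"
  by (simp flip: to_fract_mult)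

lemma vector_space_ratscale: "vector_space ratscale"
  by unfold_locales
    (simp_all add: ratscale_def ratconst_add ratconst_mult algebra_simps flip: one_pCons)

interpretation ratfun: vector_space ratscale
  by (rule vector_space_ratscale)

text \<open>
  The monic polynomials of type \<open>R\<^sub>I\<close>.  The second equation is the recurrence at \<open>n = 0\<close> with
  \<open>P\<^sub>-\<^sub>1 = 0\<close>, so \<open>a 0\<close> and \<open>lam 0\<close> do not enter.
\<close>
fun RI_P :: "(nat \<Rightarrow> complex) \<Rightarrow> (nat \<Rightarrow> complex) \<Rightarrow> (nat \<Rightarrow> complex) \<Rightarrow> nat \<Rightarrow> complex poly" where
  "RI_P b a lam 0 = 1"
| "RI_P b a lam (Suc 0) = [:- b 0, 1:]"
| "RI_P b a lam (Suc (Suc n)) =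
     [:- b (Suc n), 1:] * RI_P b a lam (Suc n) - [:lam (Suc n), a (Suc n):] * RI_P b a lam n"

definition RI_d :: "(nat \<Rightarrow> complex) \<Rightarrow> (nat \<Rightarrow> complex) \<Rightarrow> nat \<Rightarrow> complex poly" where
  "RI_d a lam m = (\<Prod>i = 1..m. [:lam i, a i:])"

definition RI_Q :: "(nat \<Rightarrow> complex) \<Rightarrow> (nat \<Rightarrow> complex) \<Rightarrow> (nat \<Rightarrow> complex) \<Rightarrow> nat \<Rightarrow> ratfun" where
  "RI_Q b a lam m = to_fract (RI_P b a lam m) / to_fract (RI_d a lam m)"

definition RI_V :: "(nat \<Rightarrow> complex) \<Rightarrow> (nat \<Rightarrow> complex) \<Rightarrow> (nat \<Rightarrow> complex) \<Rightarrow> ratfun set" where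
  "RI_V b a lam = ratfun.span {ratX ^ n * RI_Q b a lam m | n m. True}"

text \<open>
  A linear functional on \<open>V\<close> is a function on all rational functions of which only the
  restriction to \<open>V\<close> is constrained.
\<close>
definition linear_functional_on :: "ratfun set \<Rightarrow> (ratfun \<Rightarrow> complex) \<Rightarrow> bool" where
  "linear_functional_on V L \<longleftrightarrow>
     (\<forall>f\<in>V. \<forall>g\<in>V. L (f + g) = L f + L g) \<and> (\<forall>c. \<forall>f\<in>V. L (ratscale c f) = c * L f)"

definition RI_functional ::
  "(nat \<Rightarrow> complex) \<Rightarrow> (nat \<Rightarrow> complex) \<Rightarrow> (nat \<Rightarrow> complex) \<Rightarrow> (ratfun \<Rightarrow> complex) \<Rightarrow> bool" where
  "RI_functional b a lam L \<longleftrightarrow>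
     linear_functional_on (RI_V b a lam) L \<and> L 1 = 1 \<and>
     (\<forall>n m. n < m \<longrightarrow> L (ratX ^ n * RI_Q b a lam m) = 0)"

definition RI_nu ::
  "(nat \<Rightarrow> complex) \<Rightarrow> (nat \<Rightarrow> complex) \<Rightarrow> (ratfun \<Rightarrow> complex) \<Rightarrow> nat \<Rightarrow> nat \<Rightarrow> complex" where
  "RI_nu a lam L n m = L (ratX ^ n / to_fract (RI_d a lam m))"

definition RI_Delta2 ::
  "(nat \<Rightarrow> complex) \<Rightarrow> (nat \<Rightarrow> complex) \<Rightarrow> (ratfun \<Rightarrow> complex) \<Rightarrow> nat \<Rightarrow> complex" where
  "RI_Delta2 a lam L n = det (mat (n + 1) (n + 1) (\<lambda>(i, j). RI_nu a lam L (i + j) j))"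

definition RI_Delta3 ::
  "(nat \<Rightarrow> complex) \<Rightarrow> (nat \<Rightarrow> complex) \<Rightarrow> (ratfun \<Rightarrow> complex) \<Rightarrow> nat \<Rightarrow> complex" where
  "RI_Delta3 a lam L n = det (mat (n + 1) (n + 1) (\<lambda>(i, j). RI_nu a lam L i j))"

end

theory Submission
  imports Defs
begin

text \<open>
  Dividing the recurrence by \<open>d\<^sub>n\<close> and applying \<open>L\<close> gives \<open>L (x\<^sup>i Q\<^sub>n) = \<delta>\<^sub>i\<^sub>n\<close> for \<open>i \<le> n\<close>.
  Hence the coefficient vector of \<open>P\<^sub>n\<close> is mapped to the last unit vector by
  \<open>N = (\<nu>\<^sub>i\<^sub>+\<^sub>k\<^sub>,\<^sub>n)\<close>, and to \<open>Q\<^sub>n\<close> times that vector if the last row of \<open>N\<close> is replaced by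
  \<open>(x\<^sup>k/d\<^sub>n)\<close>; so the determinant of the latter matrix is \<open>Q\<^sub>n det N\<close>.  Both formulas of the theorem
  arise from this one by multiplying the two matrices on the right by the transition matrix that
  expresses \<open>x\<^sup>j/d\<^sub>j\<close>, respectively \<open>1/d\<^sub>j\<close>, in terms of the \<open>x\<^sup>k/d\<^sub>n\<close>.  This matrix is triangular up
  to the order of its rows, with nonzero diagonal products of the \<open>\<lambda>\<^sub>i\<close>, respectively of the \<open>a\<^sub>i\<close>.
\<close>

section \<open>Determinants\<close>

text \<open>Laplace expansion along the last row: the cofactors delete that row, so one
  \<open>c\<close> serves for every \<open>s\<close>. The determinant is thus linear in its last
  row.\<close>

lemma det_last_row:
  fixes r :: "nat \<Rightarrow> nat \<Rightarrow> 'a :: comm_ring_1"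
  obtains c where "\<And>s. det (mat (n + 1) (n + 1) (\<lambda>(i, j). if i < n then r i j else s j)) =
    (\<Sum>j\<le>n. s j * c j)"
proof
  let ?A = "\<lambda>s. mat (n + 1) (n + 1) (\<lambda>(i, j). if i < n then r i j else s j)"
  fix s
  have cof: "cofactor (?A s) n j = cofactor (?A (\<lambda>_. 0)) n j" for j
  proof -
    have "mat_delete (?A s) n j = mat_delete (?A (\<lambda>_. 0)) n j"
      by (rule eq_matI) (auto simp: mat_delete_def)
    then show ?thesis
      by (simp add: cofactor_def)
  qed
  have "det (?A s) = (\<Sum>j<n + 1. ?A s $$ (n, j) * cofactor (?A s) n j)"
    by (rule laplace_expansion_row) auto
  also have "\<dots> = (\<Sum>j<n + 1. s j * cofactor (?A s) n j)"
    by (intro sum.cong) auto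
  also have "\<dots> = (\<Sum>j\<le>n. s j * cofactor (?A (\<lambda>_. 0)) n j)"
    by (subst cof) (simp add: lessThan_Suc_atMost)
  finally show "det (?A s) = (\<Sum>j\<le>n. s j * cofactor (?A (\<lambda>_. 0)) n j)" .
qed

text \<open>Combine \<open>s\<close> and \<open>t\<close> into a last row \<open>u\<close>
  orthogonal to \<open>v\<close>. Then \<open>v\<close> lies in the kernel, so the determinant with
  last row \<open>u\<close> vanishes; linearity in the last row gives the claim. The
  cross-multiplied form avoids division.\<close>

lemma det_last_row_proportional:
  fixes r :: "nat \<Rightarrow> nat \<Rightarrow> 'a :: idom"
  assumes r: "\<And>i. i < n \<Longrightarrow> (\<Sum>j\<le>n. r i j * v j) = 0"
    and v: "k \<le> n" "v k \<noteq> 0"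
  shows "(\<Sum>j\<le>n. t j * v j) * det (mat (n + 1) (n + 1) (\<lambda>(i, j). if i < n then r i j else s j)) =
    (\<Sum>j\<le>n. s j * v j) * det (mat (n + 1) (n + 1) (\<lambda>(i, j). if i < n then r i j else t j))"
proof -
  let ?A = "\<lambda>s. mat (n + 1) (n + 1) (\<lambda>(i, j). if i < n then r i j else s j)"
  let ?\<alpha> = "\<Sum>j\<le>n. s j * v j" and ?\<beta> = "\<Sum>j\<le>n. t j * v j"
  define u where "u j = ?\<beta> * s j - ?\<alpha> * t j" for j
  obtain c where c: "\<And>s. det (?A s) = (\<Sum>j\<le>n. s j * c j)"
    using det_last_row[of n r] by blast
  have "(\<Sum>j\<le>n. u j * v j) = ?\<beta> * ?\<alpha> - ?\<alpha> * ?\<beta>"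
    by (simp add: u_def sum_subtractf left_diff_distrib sum_distrib_left mult.assoc)
  then have u: "(\<Sum>j\<le>n. u j * v j) = 0"
    by (simp add: mult.commute)
  have "?A u *\<^sub>v vec (n + 1) v = 0\<^sub>v (n + 1)"
  proof (rule eq_vecI)
    fix i assume "i < dim_vec (0\<^sub>v (n + 1) :: 'a vec)"
    then have i: "i < n + 1" by simp
    then have "(?A u *\<^sub>v vec (n + 1) v) $ i = (\<Sum>j\<le>n. (if i < n then r i j else u j) * v j)"
      by (auto simp: scalar_prod_def atLeast0LessThan lessThan_Suc_atMost intro!: sum.cong)
    also have "\<dots> = 0"
      using r u by (cases "i < n") simp_all
    finally show "(?A u *\<^sub>v vec (n + 1) v) $ i = 0\<^sub>v (n + 1) $ i"
      using i by simp
  qed simp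
  moreover have "vec (n + 1) v \<noteq> 0\<^sub>v (n + 1)"
  proof
    assume "vec (n + 1) v = 0\<^sub>v (n + 1)"
    then have "vec (n + 1) v $ k = 0\<^sub>v (n + 1) $ k" by simp
    with v show False by simp
  qed
  ultimately have "det (?A u) = 0"
    by (subst det_0_iff_vec_prod_zero[of _ "n + 1"]) (auto intro!: exI[of _ "vec (n + 1) v"])
  moreover have "det (?A u) = ?\<beta> * det (?A s) - ?\<alpha> * det (?A t)"
    unfolding c by (simp add: u_def sum_subtractf left_diff_distrib sum_distrib_left mult.assoc)
  ultimately show ?thesis by simp
qed

text \<open>Forward substitution in a kernel vector: row \<open>\<sigma> j\<close> determines entry
  \<open>j\<close> once the earlier entries are zero. The map \<open>\<sigma>\<close> lists the rows
  in the order of substitution, so that triangular and anti-triangular matrices are treated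
  together.\<close>

lemma det_nonzero_echelon:
  fixes T :: "nat \<Rightarrow> nat \<Rightarrow> 'a :: field"
  assumes \<sigma>: "\<And>j. j < n \<Longrightarrow> \<sigma> j < n"
    and diag: "\<And>j. j < n \<Longrightarrow> T (\<sigma> j) j \<noteq> 0"
    and zero: "\<And>j l. j < l \<Longrightarrow> l < n \<Longrightarrow> T (\<sigma> j) l = 0"
  shows "det (mat n n (\<lambda>(i, j). T i j)) \<noteq> 0"
proof
  assume "det (mat n n (\<lambda>(i, j). T i j)) = 0"
  then obtain v where v: "v \<in> carrier_vec n" "v \<noteq> 0\<^sub>v n" "mat n n (\<lambda>(i, j). T i j) *\<^sub>v v = 0\<^sub>v n"
    by (subst (asm) det_0_iff_vec_prod_zero_field[of _ n]) auto
  have "v $ j = 0" if "j < n" for j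
    using that
  proof (induction j rule: less_induct)
    case (less j)
    have "0 = (mat n n (\<lambda>(i, j). T i j) *\<^sub>v v) $ \<sigma> j"
      using v(3) \<sigma>[OF less.prems] by simp
    also have "\<dots> = (\<Sum>l<n. T (\<sigma> j) l * v $ l)"
      using v(1) \<sigma>[OF less.prems]
      by (auto simp: scalar_prod_def atLeast0LessThan intro!: sum.cong)
    \<comment> \<open>Terms with \<open>l < j\<close> vanish by induction, those with
      \<open>l > j\<close> by the echelon shape.\<close>
    also have "\<dots> = (\<Sum>l<n. if l = j then T (\<sigma> j) j * v $ j else 0)"
    proof (rule sum.cong)
      fix l assume "l \<in> {..<n}"
      then show "T (\<sigma> j) l * v $ l = (if l = j then T (\<sigma> j) j * v $ j else 0)"
        using zero[of j l] less.IH[of l] by (cases l j rule: linorder_cases) auto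
    qed simp
    also have "\<dots> = T (\<sigma> j) j * v $ j"
      using less.prems by simp
    finally show ?case
      using diag[OF less.prems] by simp
  qed
  then have "v = 0\<^sub>v n"
    using v(1) by (intro eq_vecI) auto
  with v(2) show False by simp
qed

section \<open>The embedding of polynomials into rational functions\<close>

lemma to_fract_power: "to_fract (p ^ n) = to_fract p ^ n"
  by (induction n) simp_all

lemma to_fract_monom: "to_fract (monom c k) = ratconst c * ratX ^ k"
proof -
  have "monom c k = [:c:] * [:0, 1:] ^ k"
    by (simp add: monom_altdef)
  then show ?thesis
    by (simp only: to_fract_mult to_fract_power)
qed

text \<open>The bound \<open>n\<close> may exceed the degree, so that all numerators are expanded in
  the same \<open>n + 1\<close> powers, matching the size of the matrices.\<close>

lemma to_fract_eq_sum:
  assumes "degree p \<le> n"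
  shows "to_fract p = (\<Sum>k\<le>n. ratconst (coeff p k) * ratX ^ k)"
proof -
  have "to_fract p = to_fract (\<Sum>k\<le>n. monom (coeff p k) k)"
    using assms by (simp add: poly_as_sum_of_monoms')
  then show ?thesis
    by (simp add: to_fract_monom)
qed

lemma ratconst_1: "ratconst 1 = 1"
  by (simp flip: one_pCons)

lemma comm_ring_hom_ratconst: "comm_ring_hom (\<lambda>c. ratconst c)"
  by unfold_locales (simp_all only: ratconst_add ratconst_mult ratconst_1 pCons_0_0 to_fract_0)

lemma det_ratconst:
  "det (mat n n (\<lambda>(i, j). ratconst (A i j))) = ratconst (det (mat n n (\<lambda>(i, j). A i j)))"
proof -
  interpret comm_ring_hom "\<lambda>c. ratconst c"
    by (rule comm_ring_hom_ratconst)
  have "mat n n (\<lambda>(i, j). ratconst (A i j)) = map_mat (\<lambda>c. ratconst c) (mat n n (\<lambda>(i, j). A i j))"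
    by (rule eq_matI) auto
  then show ?thesis
    using hom_det by simp
qed

lemma ratconst_sum: "ratconst (\<Sum>k\<in>A. f k) = (\<Sum>k\<in>A. ratconst (f k))"
  by (induction A rule: infinite_finite_induct) (simp_all add: ratconst_add)

section \<open>Polynomials of type \<open>R\<^sub>I\<close> and their functional\<close>

lemma RI_d_0: "RI_d a lam 0 = 1"
  by (simp add: RI_d_def)

lemma RI_d_Suc: "RI_d a lam (Suc m) = [:lam (Suc m), a (Suc m):] * RI_d a lam m"
  by (simp add: RI_d_def mult.commute)

lemma RI_d_split:
  assumes "j \<le> n"
  shows "RI_d a lam n = RI_d a lam j * (\<Prod>i = Suc j..n. [:lam i, a i:])"
proof -
  have "{1..n} = {1..j} \<union> {Suc j..n}"
    using assms by auto
  moreover have "{1..j} \<inter> {Suc j..n} = {}"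
    by auto
  ultimately show ?thesis
    by (simp add: RI_d_def prod.union_disjoint)
qed

lemma degree_RI_P_le: "degree (RI_P b a lam n) \<le> n"
proof (induction n rule: induct_nat_012)
  case (ge2 n)
  have "degree ([:- b (Suc n), 1:] * RI_P b a lam (Suc n)) \<le> Suc (Suc n)"
    using ge2 by (intro order.trans[OF degree_mult_le]) simp
  moreover have "degree ([:lam (Suc n), a (Suc n):] * RI_P b a lam n) \<le> Suc (Suc n)"
    using ge2 by (intro order.trans[OF degree_mult_le]) (simp add: degree_pCons_eq_if)
  ultimately show ?case
    by (simp only: RI_P.simps) (rule degree_diff_le)
qed simp_all

locale RI_system =
  fixes b a lam :: "nat \<Rightarrow> complex" and L :: "ratfun \<Rightarrow> complex"
  assumes a_nonzero: "n \<ge> 1 \<Longrightarrow> a n \<noteq> 0"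
    and P_nonzero: "n \<ge> 1 \<Longrightarrow> poly (RI_P b a lam n) (- lam n / a n) \<noteq> 0"
    and L: "RI_functional b a lam L"
begin

abbreviation P where "P \<equiv> RI_P b a lam"
abbreviation Q where "Q \<equiv> RI_Q b a lam"
abbreviation V where "V \<equiv> RI_V b a lam"
abbreviation d where "d m \<equiv> to_fract (RI_d a lam m)"

lemma RI_d_nonzero: "RI_d a lam m \<noteq> 0"
  using a_nonzero by (auto simp: RI_d_def)

section \<open>The space \<open>V\<close> as a module over the polynomials\<close>

lemma X_mult_in_V:
  assumes "f \<in> V"
  shows "ratX * f \<in> V"
proof -
  have "f \<in> ratfun.span {ratX ^ n * Q m | n m. True}"
    using assms by (simp add: RI_V_def)
  then show ?thesis
  proof (induction rule: ratfun.span_induct)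
    case base
    show ?case
    proof (rule ratfun.subspaceI)
      show "0 \<in> {x. ratX * x \<in> V}"
        by (simp add: RI_V_def ratfun.span_zero)
    next
      fix x y assume "x \<in> {x. ratX * x \<in> V}" "y \<in> {x. ratX * x \<in> V}"
      then show "x + y \<in> {x. ratX * x \<in> V}"
        by (simp add: RI_V_def ratfun.span_add distrib_left)
    next
      fix c x assume "x \<in> {x. ratX * x \<in> V}"
      then have "ratscale c (ratX * x) \<in> V"
        by (simp add: RI_V_def ratfun.span_scale)
      then show "ratscale c x \<in> {x. ratX * x \<in> V}"
        by (simp add: ratscale_def mult.left_commute)
    qed
  next
    case (step x)
    have "ratX * (ratX ^ n * Q m) \<in> V" for n m
      unfolding RI_V_def
      by (rule ratfun.span_base) (auto simp flip: power_Suc mult.assoc)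
    with step show ?case by blast
  qed
qed

lemma poly_mult_in_V:
  assumes "f \<in> V"
  shows "to_fract p * f \<in> V"
proof (induction p)
  case 0
  show ?case by (simp add: RI_V_def ratfun.span_zero)
next
  case (pCons c p)
  have "to_fract (pCons c p) = to_fract ([:c:] + [:0, 1:] * p)"
    by simp
  also have "\<dots> = ratconst c + ratX * to_fract p"
    by (simp only: to_fract_add to_fract_mult)
  finally have "to_fract (pCons c p) * f = ratscale c f + ratX * (to_fract p * f)"
    by (simp add: ratscale_def algebra_simps)
  moreover have "ratscale c f \<in> V"
    using assms by (simp add: RI_V_def ratfun.span_scale)
  moreover note X_mult_in_V[OF pCons.IH]
  ultimately show ?case
    by (simp add: RI_V_def ratfun.span_add)
qed

lemma Q_in_V: "Q m \<in> V"
proof -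
  have "ratX ^ 0 * Q m \<in> V"
    unfolding RI_V_def by (rule ratfun.span_base) blast
  then show ?thesis by simp
qed

text \<open>With \<open>l\<close> the new linear factor of the denominator and \<open>r\<close> its
  root, the value \<open>c\<close> of \<open>P (Suc m)\<close> at \<open>r\<close> is nonzero by
  \<open>P_nonzero\<close>. Since \<open>l\<close> divides \<open>P (Suc m) - [:c:]\<close>, the
  multiple \<open>c / d (Suc m)\<close> is \<open>Q (Suc m)\<close> minus a fraction over
  \<open>d m\<close>. That fraction has the quotient \<open>q\<close> as numerator, hence the
  induction over all \<open>p\<close>.\<close>

lemma frac_in_V: "to_fract p / d m \<in> V"
proof (induction m arbitrary: p)
  case 0
  have "Q 0 = 1" by (simp add: RI_Q_def RI_d_0)
  then have "(1 :: ratfun) \<in> V" using Q_in_V[of 0] by simp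
  from poly_mult_in_V[OF this, of p] show ?case by (simp add: RI_d_0)
next
  case (Suc m)
  define l where "l = [:lam (Suc m), a (Suc m):]"
  define r where "r = - lam (Suc m) / a (Suc m)"
  define c where "c = poly (P (Suc m)) r"
  have a: "a (Suc m) \<noteq> 0" and c: "c \<noteq> 0"
    using a_nonzero P_nonzero by (simp_all add: c_def r_def)
  have l: "l = smult (a (Suc m)) [:- r, 1:]" and l0: "l \<noteq> 0"
    using a by (simp_all add: l_def r_def)
  have "[:- r, 1:] dvd P (Suc m) - [:c:]"
    by (simp add: c_def flip: poly_eq_0_iff_dvd)
  then have "l dvd P (Suc m) - [:c:]"
    using a by (simp only: l smult_dvd_iff) simp
  then obtain q where q: "P (Suc m) - [:c:] = l * q" ..
  then have "ratconst c = to_fract (P (Suc m)) - to_fract l * to_fract q"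
    by (metis diff_diff_eq2 add_diff_cancel_left' to_fract_diff to_fract_mult)
  moreover have "d (Suc m) = to_fract l * d m"
    by (simp only: RI_d_Suc l_def to_fract_mult)
  ultimately have "ratconst c * (1 / d (Suc m)) = Q (Suc m) - to_fract q / d m"
    using l0 RI_d_nonzero[of m] by (simp add: RI_Q_def field_simps)
  then have "ratscale c (1 / d (Suc m)) \<in> V"
    using Q_in_V[of "Suc m"] Suc.IH[of q] by (simp add: ratscale_def RI_V_def ratfun.span_diff)
  then have "ratscale (1 / c) (ratscale c (1 / d (Suc m))) \<in> V"
    unfolding RI_V_def by (rule ratfun.span_scale)
  then have "1 / d (Suc m) \<in> V"
    using c by simp
  from poly_mult_in_V[OF this, of p] show ?case by simp
qed

section \<open>Values of the functional \<open>L\<close>\<close>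

lemma L_add: "f \<in> V \<Longrightarrow> g \<in> V \<Longrightarrow> L (f + g) = L f + L g"
  and L_scale: "f \<in> V \<Longrightarrow> L (ratscale c f) = c * L f"
  using L by (auto simp: RI_functional_def linear_functional_on_def)

lemma L_zero: "L 0 = 0"
  using L_scale[of 0 0] by (simp add: RI_V_def ratfun.span_zero)

lemma L_sum:
  assumes "\<And>k. k \<in> A \<Longrightarrow> f k \<in> V"
  shows "L (\<Sum>k\<in>A. ratscale (c k) (f k)) = (\<Sum>k\<in>A. c k * L (f k))"
  using assms
proof (induction A rule: infinite_finite_induct)
  case (insert x A)
  then have "ratscale (c x) (f x) \<in> V" "(\<Sum>k\<in>A. ratscale (c k) (f k)) \<in> V"
    by (auto simp: RI_V_def intro: ratfun.span_scale ratfun.span_sum)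
  with insert show ?case
    by (simp add: L_add L_scale)
qed (simp_all add: L_zero)

lemma X_power_mult_in_V: "f \<in> V \<Longrightarrow> ratX ^ n * f \<in> V"
  using poly_mult_in_V[of f "[:0, 1:] ^ n"] by (simp add: to_fract_power)

text \<open>Expanding \<open>p\<close> in monomials turns the value of \<open>L\<close> into row
  \<open>i\<close> of the moment matrix applied to the coefficient vector of
  \<open>p\<close>.\<close>

lemma L_X_power_frac:
  assumes "degree p \<le> n"
  shows "L (ratX ^ i * (to_fract p / d m)) = (\<Sum>k\<le>n. RI_nu a lam L (i + k) m * coeff p k)"
proof -
  have "ratX ^ i * (to_fract p / d m) =
      (\<Sum>k\<le>n. ratscale (coeff p k) (ratX ^ (i + k) / d m))"
    unfolding to_fract_eq_sum[OF assms]
    by (simp add: ratscale_def sum_distrib_left sum_divide_distrib power_add algebra_simps)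
  moreover have "ratX ^ k / d m \<in> V" for k
    using frac_in_V[of "[:0, 1:] ^ k"] by (simp add: to_fract_power)
  ultimately show ?thesis
    by (simp add: L_sum RI_nu_def mult.commute)
qed

lemma L_X_power_Q: "i < n \<Longrightarrow> L (ratX ^ i * Q n) = 0"
  using L by (simp add: RI_functional_def)

text \<open>This is the recurrence of \<open>P\<close> divided by \<open>d (Suc n)\<close>. The
  factor multiplying \<open>P n\<close> cancels against the last factor of \<open>d (Suc n)\<close>,
  so \<open>Q n\<close> appears with coefficient of modulus one.\<close>

lemma Q_recurrence:
  "to_fract [:lam (Suc (Suc n)), a (Suc (Suc n)):] * Q (Suc (Suc n)) =
    to_fract [:- b (Suc n), 1:] * Q (Suc n) - Q n"
proof -
  define l where "l = [:lam (Suc n), a (Suc n):]"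
  define l' where "l' = [:lam (Suc (Suc n)), a (Suc (Suc n)):]"
  have nz: "l \<noteq> 0" "l' \<noteq> 0" "RI_d a lam n \<noteq> 0"
    using a_nonzero[of "Suc n"] a_nonzero[of "Suc (Suc n)"] RI_d_nonzero by (simp_all add: l_def l'_def)
  have d: "d (Suc n) = to_fract l * d n" "d (Suc (Suc n)) = to_fract l' * (to_fract l * d n)"
    by (simp_all only: RI_d_Suc l_def l'_def to_fract_mult)
  \<comment> \<open>Here \<open>x\<close>, \<open>y\<close>, \<open>z\<close> stand for the images
    of \<open>l\<close>, \<open>l'\<close> and \<open>d n\<close>, and \<open>B\<close> for that of
    the factor \<open>[:- b (Suc n), 1:]\<close>.\<close>
  have cancel: "y * ((B * p1 - x * p0) / (y * (x * z))) = B * (p1 / (x * z)) - p0 / z"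
    if "x \<noteq> 0" "y \<noteq> 0" "z \<noteq> 0" for x y z B p0 p1 :: ratfun
    using that by (simp add: field_simps)
  have "to_fract (P (Suc (Suc n))) =
      to_fract [:- b (Suc n), 1:] * to_fract (P (Suc n)) - to_fract l * to_fract (P n)"
    by (simp only: RI_P.simps l_def to_fract_diff to_fract_mult)
  then show ?thesis
    unfolding RI_Q_def d l'_def[symmetric] using nz by (simp only:) (rule cancel, simp_all)
qed

text \<open>Multiply the recurrence by x^n and apply \<open>L\<close>. The terms with
  \<open>b\<close>, \<open>lam\<close> and \<open>a\<close> vanish, since their powers of x are
  below the index of \<open>Q\<close>; what remains equates the value at \<open>Suc n\<close> with
  that at \<open>n\<close>.\<close>

lemma L_X_power_Q_self: "L (ratX ^ n * Q n) = 1"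
proof (induction n)
  case 0
  then show ?case
    using L by (simp add: RI_functional_def RI_Q_def RI_d_0)
next
  case (Suc n)
  have lin: "to_fract [:u, v:] = ratconst u + ratconst v * ratX" for u v :: complex
    by (simp flip: to_fract_mult to_fract_add)
  define q q' q'' where "q = ratX ^ n * Q n" and "q' = Q (Suc n)" and "q'' = Q (Suc (Suc n))"
  have "ratX ^ Suc n * q' =
      ratscale 1 q + ratscale (b (Suc n)) (ratX ^ n * q')
      + (ratscale (lam (Suc (Suc n))) (ratX ^ n * q'') + ratscale (a (Suc (Suc n))) (ratX ^ Suc n * q''))"
  proof -
    have "ratconst (- b (Suc n)) = - ratconst (b (Suc n))"
      by (simp flip: to_fract_uminus)
    with Q_recurrence[of n, unfolded lin[of "lam _"] lin[of "- b _"]]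
    have "ratX * q' = Q n + ratconst (b (Suc n)) * q' +
        (ratconst (lam (Suc (Suc n))) + ratconst (a (Suc (Suc n))) * ratX) * q''"
      by (simp only: q'_def q''_def ratconst_1) (simp add: algebra_simps)
    then have "ratX ^ n * (ratX * q') = ratX ^ n * (Q n + ratconst (b (Suc n)) * q' +
        (ratconst (lam (Suc (Suc n))) + ratconst (a (Suc (Suc n))) * ratX) * q'')"
      by simp
    then show ?thesis
      by (simp add: ratscale_def q_def ratconst_1 algebra_simps)
  qed
  moreover have "L (ratX ^ n * q') = 0" "L (ratX ^ n * q'') = 0" "L (ratX ^ Suc n * q'') = 0"
    unfolding q'_def q''_def by (rule L_X_power_Q; simp)+
  moreover have "q \<in> V" "ratX ^ n * q' \<in> V" "ratX ^ n * q'' \<in> V" "ratX ^ Suc n * q'' \<in> V"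
    unfolding q_def q'_def q''_def by (rule X_power_mult_in_V Q_in_V)+
  moreover have "L q = 1"
    using Suc.IH by (simp add: q_def)
  moreover have scale_in_V: "f \<in> V \<Longrightarrow> ratscale c f \<in> V"
    and add_in_V: "f \<in> V \<Longrightarrow> g \<in> V \<Longrightarrow> f + g \<in> V" for f g c
    by (simp_all add: RI_V_def ratfun.span_scale ratfun.span_add)
  ultimately show ?case
    by (simp only: L_add L_scale scale_in_V add_in_V flip: q'_def) simp
qed

section \<open>Determinant formulas over the common denominator \<open>d n\<close>\<close>

lemma det_common_denominator:
  "det (mat (n + 1) (n + 1) (\<lambda>(i, k). if i < n then ratconst (RI_nu a lam L (i + k) n)
      else ratX ^ k / d n)) =
    Q n * ratconst (det (mat (n + 1) (n + 1) (\<lambda>(i, k). RI_nu a lam L (i + k) n)))"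
proof -
  let ?r = "\<lambda>i k. ratconst (RI_nu a lam L (i + k) n)"
  \<comment> \<open>The coefficient vector of \<open>P n\<close> pairs to 0 with the moment rows
    \<open>i < n\<close>, to 1 with row \<open>n\<close>, and to \<open>Q n\<close> with the row of
    functions.\<close>
  let ?v = "\<lambda>k. ratconst (coeff (P n) k)"
  have row: "(\<Sum>k\<le>n. ?r i k * ?v k) = ratconst (L (ratX ^ i * Q n))" for i
    using L_X_power_frac[OF degree_RI_P_le[of b a lam n], of i n]
    by (simp add: RI_Q_def ratconst_sum ratconst_mult)
  have "(\<Sum>k\<le>n. ratX ^ k / d n * ?v k) = Q n"
    unfolding RI_Q_def to_fract_eq_sum[OF degree_RI_P_le, of b a lam n]
    by (simp add: sum_divide_distrib mult.commute)
  moreover have "(\<Sum>k\<le>n. ?r n k * ?v k) = 1"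
    by (simp only: row L_X_power_Q_self ratconst_1)
  \<comment> \<open>A vector pairing to 1 with row \<open>n\<close> cannot be zero.\<close>
  moreover obtain k where "k \<le> n" "?v k \<noteq> 0"
  proof -
    have "\<exists>k\<le>n. ?v k \<noteq> 0"
    proof (rule ccontr)
      assume "\<not> (\<exists>k\<le>n. ?v k \<noteq> 0)"
      then have "(\<Sum>k\<le>n. ?r n k * ?v k) = 0" by simp
      then show False
        using \<open>(\<Sum>k\<le>n. ?r n k * ?v k) = 1\<close> by simp
    qed
    then show ?thesis using that by blast
  qed
  moreover have "(\<Sum>k\<le>n. ?r i k * ?v k) = 0" if "i < n" for i
    using that by (simp add: row L_X_power_Q)
  moreover have "mat (n + 1) (n + 1) (\<lambda>(i, k). if i < n then ?r i k else ?r n k) =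
      mat (n + 1) (n + 1) (\<lambda>(i, k). ?r i k)"
    by (rule eq_matI) (auto simp: less_Suc_eq)
  ultimately show ?thesis
    using det_last_row_proportional[of n ?r ?v k "?r n" "\<lambda>k. ratX ^ k / d n"]
    by (simp add: det_ratconst)
qed

text \<open>Expressing \<open>u j\<close> through the x^k / d_n multiplies both the moment matrix
  and the matrix with the function row on the right by the same \<open>?T\<close>. Its determinant
  cancels in the quotient, which reduces the claim to \<open>det_common_denominator\<close>.\<close>

lemma Q_eq_det:
  fixes w :: "nat \<Rightarrow> complex poly"
  assumes deg: "\<And>j. j \<le> n \<Longrightarrow> degree (w j) \<le> n"
    and T: "det (mat (n + 1) (n + 1) (\<lambda>(k, j). coeff (w j) k)) \<noteq> 0"
    and N: "det (mat (n + 1) (n + 1) (\<lambda>(i, k). RI_nu a lam L (i + k) n)) \<noteq> 0"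
    and u: "\<And>j. j \<le> n \<Longrightarrow> u j = to_fract (w j) / d n"
    and \<mu>: "\<And>i j. j \<le> n \<Longrightarrow> \<mu> i j = L (ratX ^ i * u j)"
  shows "Q n = 1 / ratconst (det (mat (n + 1) (n + 1) (\<lambda>(i, j). \<mu> i j))) *
    det (mat (n + 1) (n + 1) (\<lambda>(i, j). if i < n then ratconst (\<mu> i j) else u j))"
proof -
  let ?mat = "\<lambda>f. mat (n + 1) (n + 1) (\<lambda>(i, j). f i j)"
  let ?N = "mat (n + 1) (n + 1) (\<lambda>(i, k). RI_nu a lam L (i + k) n)"
  let ?T = "mat (n + 1) (n + 1) (\<lambda>(k, j). coeff (w j) k)"
  let ?B = "mat (n + 1) (n + 1) (\<lambda>(i, k). if i < n then ratconst (RI_nu a lam L (i + k) n)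
    else ratX ^ k / d n)"
  let ?T' = "mat (n + 1) (n + 1) (\<lambda>(k, j). ratconst (coeff (w j) k))"
  let ?A = "mat (n + 1) (n + 1) (\<lambda>(i, j). if i < n then ratconst (\<mu> i j) else u j)"
  have \<mu>_sum: "\<mu> i j = (\<Sum>k\<le>n. RI_nu a lam L (i + k) n * coeff (w j) k)" if "j \<le> n" for i j
    using that L_X_power_frac[OF deg[OF that], of i n] by (simp add: \<mu> u)
  have u_sum: "u j = (\<Sum>k\<le>n. ratX ^ k / d n * ratconst (coeff (w j) k))" if "j \<le> n" for j
    unfolding u[OF that] to_fract_eq_sum[OF deg[OF that]]
    by (simp add: sum_divide_distrib mult.commute)
  have "?mat \<mu> = ?N * ?T"
    by (rule eq_matI)
      (auto simp: \<mu>_sum scalar_prod_def atLeast0LessThan lessThan_Suc_atMost intro!: sum.cong)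
  then have M: "det (?mat \<mu>) = det ?N * det ?T"
    by (simp add: det_mult[of _ "n + 1"])
  have "?A = ?B * ?T'"
    by (rule eq_matI)
      (auto simp: \<mu>_sum u_sum scalar_prod_def atLeast0LessThan lessThan_Suc_atMost
        ratconst_sum ratconst_mult intro!: sum.cong)
  then have "det ?A = det ?B * det ?T'"
    by (simp add: det_mult[of _ "n + 1"])
  also have "\<dots> = Q n * ratconst (det (?mat \<mu>))"
    unfolding det_common_denominator det_ratconst M by (simp add: ratconst_mult)
  finally show ?thesis
    using M N T by simp
qed

end

theorem theorem6p6:
  fixes b a lam :: "nat \<Rightarrow> complex" and L :: "ratfun \<Rightarrow> complex"
  assumes "\<forall>n\<ge>1. a n \<noteq> 0"
    and "\<forall>n\<ge>1. poly (RI_P b a lam n) (- lam n / a n) \<noteq> 0"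
    and "RI_functional b a lam L"
    and "\<forall>n. det (mat (n + 1) (n + 1) (\<lambda>(i, j). RI_nu a lam L (i + j) n)) \<noteq> 0"
  shows "((\<forall>k. lam k \<noteq> 0) \<longrightarrow>
           (\<forall>n. RI_Q b a lam n =
              1 / ratconst (RI_Delta2 a lam L n) *
              det (mat (n + 1) (n + 1) (\<lambda>(i, j).
                if i < n then ratconst (RI_nu a lam L (i + j) j)
                else ratX ^ j / to_fract (RI_d a lam j)))))
       \<and> (\<forall>n. RI_Q b a lam n =
              1 / ratconst (RI_Delta3 a lam L n) *
              det (mat (n + 1) (n + 1) (\<lambda>(i, j).
                if i < n then ratconst (RI_nu a lam L i j)
                else 1 / to_fract (RI_d a lam j))))"
proof -
  interpret RI_system b a lam L
    using assms by unfold_locales auto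
  \<comment> \<open>\<open>e n j\<close> is d_n / d_j, the product of the factors missing from d_j;
    it brings 1 / d_j to the denominator d_n.\<close>
  define e where "e n j = (\<Prod>i = Suc j..n. [:lam i, a i:])" for n j
  have e_nonzero: "e n j \<noteq> 0" for n j
    using a_nonzero by (auto simp: e_def)
  have degree_e: "degree (e n j) = n - j" for n j
  proof -
    \<comment> \<open>Each factor has degree exactly 1 because \<open>a i\<close> is nonzero for
      \<open>i \<ge> 1\<close>.\<close>
    have "degree (e n j) = (\<Sum>i = Suc j..n. degree [:lam i, a i:])"
      unfolding e_def using a_nonzero by (intro degree_prod_eq_sum_degree) auto
    also have "\<dots> = (\<Sum>i = Suc j..n. 1)"
      using a_nonzero by (intro sum.cong) auto
    finally show ?thesis by simp
  qed
  have d: "d n = d j * to_fract (e n j)" if "j \<le> n" for n j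
    by (simp add: RI_d_split[OF that] e_def)
  have "Q n = 1 / ratconst (RI_Delta2 a lam L n) *
      det (mat (n + 1) (n + 1) (\<lambda>(i, j).
        if i < n then ratconst (RI_nu a lam L (i + j) j) else ratX ^ j / d j))"
    if lam: "\<forall>k. lam k \<noteq> 0" for n
    unfolding RI_Delta2_def
  proof (rule Q_eq_det)
    let ?w = "\<lambda>j. monom 1 j * e n j"
    show "degree (?w j) \<le> n" if "j \<le> n" for j
      using that degree_mult_le[of "monom 1 j" "e n j"] by (simp add: degree_e degree_monom_eq)
    show "det (mat (n + 1) (n + 1) (\<lambda>(k, j). coeff (?w j) k)) \<noteq> 0"
    \<comment> \<open>The factor x^j makes the matrix lower triangular. Its diagonal entry is the
      constant term of \<open>e n j\<close>, the product of the \<open>lam i\<close> with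
      \<open>j < i \<le> n\<close>.\<close>
    proof (rule det_nonzero_echelon[where \<sigma> = "\<lambda>j. j"])
      fix j
      have "coeff (?w j) j = poly (e n j) 0"
        by (simp add: coeff_monom_mult poly_0_coeff_0)
      then show "coeff (?w j) j \<noteq> 0"
        using lam by (simp add: e_def poly_prod)
    qed (simp_all add: coeff_monom_mult)
    show "ratX ^ j / d j = to_fract (?w j) / d n" if "j \<le> n" for j
      using e_nonzero[of n j] by (simp add: d[OF that] to_fract_monom ratconst_1)
    show "RI_nu a lam L (i + j) j = L (ratX ^ i * (ratX ^ j / d j))" for i j
      by (simp add: RI_nu_def power_add)
  qed (use assms(4) in auto)
  moreover have "Q n = 1 / ratconst (RI_Delta3 a lam L n) *
      det (mat (n + 1) (n + 1) (\<lambda>(i, j).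
        if i < n then ratconst (RI_nu a lam L i j) else 1 / d j))" for n
    unfolding RI_Delta3_def
  proof (rule Q_eq_det)
    show "degree (e n j) \<le> n" for j
      by (simp add: degree_e)
    show "det (mat (n + 1) (n + 1) (\<lambda>(k, j). coeff (e n j) k)) \<noteq> 0"
    \<comment> \<open>Row \<open>n - j\<close> meets column \<open>j\<close> in the leading
      coefficient of \<open>e n j\<close>; columns \<open>l > j\<close> have degree
      \<open>n - l < n - j\<close> and vanish there.\<close>
    proof (rule det_nonzero_echelon[where \<sigma> = "\<lambda>j. n - j"])
      show "coeff (e n j) (n - j) \<noteq> 0" for j
        using e_nonzero[of n j] by (metis degree_e leading_coeff_0_iff)
      show "coeff (e n l) (n - j) = 0" if "j < l" "l < n + 1" for j l
        using that by (intro coeff_eq_0) (simp add: degree_e)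
    qed simp
    show "1 / d j = to_fract (e n j) / d n" if "j \<le> n" for j
      using e_nonzero[of n j] by (simp add: d[OF that])
    show "RI_nu a lam L i j = L (ratX ^ i * (1 / d j))" for i j
      by (simp add: RI_nu_def)
  qed (use assms(4) in auto)
  ultimately show ?thesis by blast
qed

end
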